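(* Let $A_0\in\mathbb{R}^{m\times n}$ and let $W\in\mathbb{R}^{n}$ be a nonzero vector such that the $(m+1)\times n$ matrix $F_0=\begin{pmatrix}A_0\\ W^T\end{pmatrix}$ has rank at least $n-1$. Put $C=A_0A_0^T\in\mathbb{R}^{m\times m}$, $Z=A_0W\in\mathbb{R}^m$, and $$S'=\{A\in\mathbb{R}^{m\times n} : AA^T=C,\ AW=Z\}.$$ Then $S'$ is a real algebraic set of dimension exactly $\frac{(n-1)(n-2)}{2}$.
   Context: Dimension refers to the dimension of a real algebraic (semialgebraic) subset of $\mathbb{R}^{m\times n}$; the paper calls it the "degrees of freedom" of $A$ under the joint quadratic constraint $AA^T=C$ and linear constraint $AW=Z$. *)

theory Defs
  imports "HOL-Analysis.Analysis"
begin

inductive_set poly_fun :: "('a::euclidean_space \<Rightarrow> real) set" where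
  pf_const: "(\<lambda>x. c) \<in> poly_fun"
| pf_coord: "b \<in> Basis \<Longrightarrow> (\<lambda>x. x \<bullet> b) \<in> poly_fun"
| pf_add: "p \<in> poly_fun \<Longrightarrow> q \<in> poly_fun \<Longrightarrow> (\<lambda>x. p x + q x) \<in> poly_fun"
| pf_mult: "p \<in> poly_fun \<Longrightarrow> q \<in> poly_fun \<Longrightarrow> (\<lambda>x. p x * q x) \<in> poly_fun"

definition real_algebraic_set :: "'a::euclidean_space set \<Rightarrow> bool" where
  "real_algebraic_set S \<longleftrightarrow>
     (\<exists>P. finite P \<and> P \<subseteq> poly_fun \<and> S = {x. \<forall>p\<in>P. p x = 0})"

definition contains_dim_cell :: "'a::euclidean_space set \<Rightarrow> nat \<Rightarrow> bool" where
  "contains_dim_cell S d \<longleftrightarrow>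
     (\<exists>(T::'a set) U (f::'a \<Rightarrow> 'a). subspace T \<and> dim T = d \<and> openin (top_of_set T) U \<and> U \<noteq> {} \<and>
              f ` U \<subseteq> S \<and> homeomorphism U (f ` U) f (inv_into U f))"

text \<open>Dimension of a (semi)algebraic set: the largest d such that S contains a
  topological d-cell.  For semialgebraic sets this agrees with the usual dimension.\<close>
definition alg_dim :: "'a::euclidean_space set \<Rightarrow> nat" where
  "alg_dim S = (GREATEST d. contains_dim_cell S d)"

end

theory Submission
  imports Defs
begin

text \<open>
  The fibre is the orbit \<open>A\<^sub>0 G\<close>, where \<open>G \<cong> O(n - 1)\<close> is the stabilizer of \<open>W\<close> in \<open>O(n)\<close>.
  The Cayley transform \<open>K \<mapsto> 2 (1 + K)\<^sup>-\<^sup>1 - 1 = (1 - K) (1 + K)\<^sup>-\<^sup>1\<close> parametrizes \<open>G\<close> near the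
  identity by the skew matrices killing \<open>W\<close>, a space of dimension \<open>(n - 1)(n - 2)/2\<close>. Since the
  rows of \<open>A\<^sub>0\<close> together with \<open>W\<close> span at least a hyperplane, \<open>K \<mapsto> A\<^sub>0 cayley(K)\<close> is still
  injective, which yields a cell of that dimension. Conversely, as \<open>G\<close> is compact, every point of
  the fibre close to \<open>A\<close> is \<open>A R\<close> with \<open>R \<in> G\<close> close to the identity; so each cell in the fibre
  contains a smaller one that embeds into the space of skew matrices, and invariance of domain
  bounds its dimension.
\<close>

section \<open>Polynomial functions and rows of matrix products\<close>

lemma poly_fun_sum:
  assumes "finite I" "\<And>i. i \<in> I \<Longrightarrow> p i \<in> poly_fun"
  shows "(\<lambda>x. \<Sum>i\<in>I. p i x) \<in> poly_fun"
  using assms by (induction I rule: finite_induct) (auto intro: poly_fun.intros)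

lemma poly_fun_entry: "(\<lambda>A::real^'n^'m. A $ i $ j) \<in> poly_fun"
proof -
  have "(\<lambda>A::real^'n^'m. A \<bullet> axis i (axis j 1)) \<in> poly_fun"
    by (rule pf_coord) (auto simp: Basis_vec_def)
  then show ?thesis
    by (simp add: inner_axis)
qed

lemma row_matrix_mult:
  "(A ** Q) $ i = transpose Q *v (A $ i)" for A :: "real^'n^'m" and Q :: "real^'k^'n"
  by (simp add: vec_eq_iff matrix_matrix_mult_def matrix_vector_mult_def transpose_def mult.commute)

subsection \<open>Gram fibres as algebraic sets\<close>

text \<open>Being a fibre of a map, it does not depend on the base point chosen in it; the upper
  bound uses this to move the base point.\<close>

definition gram_fibre :: "real^'n^'m \<Rightarrow> real^'n \<Rightarrow> (real^'n^'m) set" where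
  "gram_fibre A0 W = {A. A ** transpose A = A0 ** transpose A0 \<and> A *v W = A0 *v W}"

lemma gram_entry: "(A ** transpose A) $ i $ j = A $ i \<bullet> A $ j" for A :: "real^'n^'m"
  by (simp add: matrix_matrix_mult_def transpose_def inner_vec_def)

lemma mult_vec_entry: "(A *v x) $ i = A $ i \<bullet> x" for A :: "real^'n^'m"
  by (simp add: matrix_vector_mult_def inner_vec_def)

lemma gram_fibre_iff:
  "A \<in> gram_fibre A0 W \<longleftrightarrow>
    (\<forall>i j. A $ i \<bullet> A $ j = A0 $ i \<bullet> A0 $ j) \<and> (\<forall>i. A $ i \<bullet> W = A0 $ i \<bullet> W)"
  unfolding gram_fibre_def by (simp add: vec_eq_iff gram_entry mult_vec_entry)

lemma real_algebraic_gram_fibre: "real_algebraic_set (gram_fibre A0 W)"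
  for A0 :: "real^'n^'m"
proof -
  \<comment> \<open>Constants enter as \<open>+ - c\<close> because \<open>poly_fun\<close> has
    rules for sums but none for differences.\<close>
  let ?P = "range (\<lambda>(i,j) (A::real^'n^'m). (\<Sum>k\<in>UNIV. A $ i $ k * A $ j $ k) + - (A0 $ i \<bullet> A0 $ j))
     \<union> range (\<lambda>i (A::real^'n^'m). (\<Sum>k\<in>UNIV. A $ i $ k * W $ k) + - (A0 $ i \<bullet> W))"
  have "finite ?P" by simp
  moreover have "?P \<subseteq> poly_fun"
    by (auto intro!: pf_add pf_mult pf_const poly_fun_sum poly_fun_entry
        simp del: uminus_add_conv_diff add_uminus_conv_diff)
  moreover have "gram_fibre A0 W = {A. \<forall>p\<in>?P. p A = 0}"
    by (auto simp: gram_fibre_iff inner_vec_def ball_Un)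
  ultimately show ?thesis
    unfolding real_algebraic_set_def by blast
qed

text \<open>Rank-nullity relative to \<open>S\<close>: the orthogonal complement of the kernel
  inside \<open>S\<close> maps bijectively onto the image.\<close>

lemma dim_kernel_image:
  fixes f :: "'a::euclidean_space \<Rightarrow> 'b::euclidean_space"
  assumes "linear f" "subspace S"
  shows "dim {x\<in>S. f x = 0} + dim (f ` S) = dim S"
proof -
  let ?K = "{x\<in>S. f x = 0}"
  let ?T = "{y\<in>S. \<forall>x\<in>?K. orthogonal x y}"
  have K: "subspace ?K"
    using assms by (auto simp: subspace_def linear_add linear_scale linear_0)
  have T: "subspace ?T"
    using assms(2) by (auto simp: subspace_def orthogonal_clauses)
  have "dim ?T + dim ?K = dim S"
    by (rule dim_subspace_orthogonal_to_vectors) (use K assms in auto)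
  moreover have "inj_on f ?T"
  proof (rule inj_onI)
    fix x y assume *: "x \<in> ?T" "y \<in> ?T" "f x = f y"
    then have "x - y \<in> ?T" using T subspace_diff by blast
    moreover have "x - y \<in> ?K"
      using * assms by (auto simp: linear_diff subspace_diff)
    ultimately have "orthogonal (x - y) (x - y)" by blast
    then show "x = y" by (simp add: orthogonal_self)
  qed
  then have "dim (f ` ?T) = dim ?T"
    using T assms(1) by (intro dim_image_eq) (auto simp: span_eq_iff[THEN iffD2])
  moreover have "f ` S = f ` ?T"
  proof -
    have "f x \<in> f ` ?T" if "x \<in> S" for x
    proof -
      obtain y z where yz: "y \<in> span ?K" "\<And>w. w \<in> span ?K \<Longrightarrow> orthogonal z w" "x = y + z"
        using orthogonal_subspace_decomp_exists[of ?K x] by blast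
      have y: "y \<in> ?K" using yz(1) K by (simp add: span_eq_iff[THEN iffD2])
      then have "z \<in> S" using yz(3) that assms(2)
        by (metis (no_types, lifting) add_diff_cancel_left' mem_Collect_eq subspace_diff)
      then have "z \<in> ?T" using yz(2) span_superset[of ?K] by (auto simp: orthogonal_commute)
      moreover have "f x = f z" using yz(3) y assms(1) by (simp add: linear_add)
      ultimately show ?thesis by blast
    qed
    then show ?thesis by auto
  qed
  ultimately show ?thesis by simp
qed

subsection \<open>Skew matrices vanishing on a subspace\<close>

text \<open>For \<open>V = {W}\<close> this is the Lie algebra of the stabilizer of \<open>W\<close>
  in O(n). General \<open>V\<close> serves the induction on codimension and the rigidity
  argument.\<close>

definition skew_killing :: "(real^'n) set \<Rightarrow> (real^'n^'n) set" where
  "skew_killing V = {K. transpose K = - K \<and> (\<forall>x\<in>V. K *v x = 0)}"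

lemma transpose_add: "transpose (A + B) = transpose A + transpose B"
  by (simp add: transpose_def vec_eq_iff)

lemma transpose_diff: "transpose (A - B) = transpose A - transpose B"
  by (simp add: transpose_def vec_eq_iff)

lemma minus_matrix_vector: "(- A) *v x = - (A *v x)" for A :: "real^'n^'m"
  by (simp add: matrix_vector_mult_def vec_eq_iff sum_negf)

lemma linear_apply_matrix: "linear (\<lambda>A::real^'n^'m. A *v x)"
  by (rule linearI) (simp_all add: matrix_vector_mult_add_rdistrib scaleR_matrix_vector_assoc[symmetric])

lemma subspace_skew_killing: "subspace (skew_killing V)"
proof -
  have "transpose (0 :: real^'n^'n) = 0"
    by (simp add: transpose_def vec_eq_iff)
  then show ?thesis
    by (auto simp: subspace_def skew_killing_def transpose_add transpose_scalar
        matrix_vector_mult_add_rdistrib scaleR_matrix_vector_assoc[symmetric])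
qed

lemma skew_dot:
  fixes K :: "real^'n^'n"
  assumes "transpose K = - K"
  shows "x \<bullet> (K *v y) = - ((K *v x) \<bullet> y)"
proof -
  have "x v* K = transpose K *v x"
    by (metis transpose_transpose vector_transpose_matrix)
  then show ?thesis
    using dot_lmul_matrix[of x K y] assms by (simp add: minus_matrix_vector)
qed

lemma skew_killing_span:
  fixes V :: "(real^'n) set"
  shows "skew_killing (span V) = skew_killing V"
proof -
  have "K *v x = 0" if "\<forall>x\<in>V. K *v x = 0" "x \<in> span V" for K :: "real^'n^'n" and x
    using that(2,1) by (induction rule: span_induct)
     (auto simp: subspace_def matrix_vector_right_distrib matrix_vector_mult_scaleR)
  then show ?thesis
    using span_superset[of V] unfolding skew_killing_def by auto
qed

text \<open>The bivector y e^T - e y^T, from which preimages under \<open>K \<mapsto> K e\<close>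
  are built.\<close>

definition wedge :: "real^'n \<Rightarrow> real^'n \<Rightarrow> real^'n^'n" where
  "wedge y e = (\<chi> i j. y $ i * e $ j - e $ i * y $ j)"

lemma transpose_wedge: "transpose (wedge y e) = - wedge y e"
  by (simp add: wedge_def transpose_def vec_eq_iff mult.commute)

lemma wedge_apply: "wedge y e *v x = (e \<bullet> x) *\<^sub>R y - (y \<bullet> x) *\<^sub>R e"
  by (simp add: vec_eq_iff wedge_def matrix_vector_mult_def inner_vec_def right_diff_distrib
      left_diff_distrib sum_subtractf sum_distrib_left sum_distrib_right mult_ac)

text \<open>Induction on the codimension of \<open>V\<close>: for \<open>e\<close> orthogonal to \<open>V\<close>, the map
  \<open>K \<mapsto> K e\<close> sends the space onto the orthogonal complement of \<open>V + \<real>e\<close>, and its kernel is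
  the corresponding space for \<open>V + \<real>e\<close>.\<close>

lemma dim_skew_killing:
  fixes V :: "(real^'n) set"
  shows "dim (skew_killing V) = (CARD('n) - dim V) choose 2"
proof (induction "CARD('n) - dim V" arbitrary: V)
  case 0
  then have "span V = UNIV"
    using dim_eq_full[of V] dim_subset_UNIV[of V] by (simp add: le_antisym)
  then have "skew_killing V \<subseteq> {0}"
    unfolding skew_killing_span[of V, symmetric] by (auto simp: skew_killing_def matrix_eq)
  then have "dim (skew_killing V) = 0" by (simp add: dim_eq_0)
  then show ?case using 0 by (metis binomial_eq_0_iff zero_less_numeral)
next
  case (Suc k)
  have dV: "dim V < CARD('n)" using Suc.hyps(2) by linarith
  then obtain e where e: "e \<noteq> 0" "\<And>x. x \<in> span V \<Longrightarrow> orthogonal e x"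
    using orthogonal_to_subspace_exists[of V] by (metis DIM_cart DIM_real mult.right_neutral)
  let ?V = "insert e V"
  have "e \<notin> span V" using e by (metis orthogonal_self)
  then have d: "dim ?V = Suc (dim V)" by (simp add: dim_insert)
  let ?f = "\<lambda>K::real^'n^'n. K *v e"
  have ker: "{K\<in>skew_killing V. ?f K = 0} = skew_killing ?V"
    by (auto simp: skew_killing_def)
  let ?O = "{y\<in>UNIV. \<forall>x\<in>span ?V. orthogonal x y}"
  have "?f ` skew_killing V = ?O"
  proof
    show "?f ` skew_killing V \<subseteq> ?O"
    proof clarsimp
      fix K x assume K: "K \<in> skew_killing V" and x: "x \<in> span ?V"
      then have K': "transpose K = - K" by (auto simp: skew_killing_def)
      have "?V \<subseteq> {x. orthogonal x (K *v e)}"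
      proof -
        have "e \<bullet> (K *v e) = 0"
          using skew_dot[OF K', of e e] by (simp add: inner_commute)
        moreover have "z \<bullet> (K *v e) = 0" if "z \<in> V" for z
          unfolding skew_dot[OF K', of z e] using K that by (simp add: skew_killing_def)
        ultimately show ?thesis by (auto simp: orthogonal_def)
      qed
      then have "span ?V \<subseteq> {x. orthogonal x (K *v e)}"
        by (rule span_minimal) (auto simp: subspace_def orthogonal_clauses)
      then show "orthogonal x (K *v e)" using x by auto
    qed
    show "?O \<subseteq> ?f ` skew_killing V"
    proof
      fix y assume y: "y \<in> ?O"
      have ve: "e \<bullet> v = 0" "y \<bullet> v = 0" if "v \<in> V" for v
        using that e(2)[of v] y by (auto simp: orthogonal_def span_base inner_commute)
      have ye: "y \<bullet> e = 0"
        using y by (auto simp: orthogonal_def span_base inner_commute)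
      \<comment> \<open>Since \<open>y\<close> is orthogonal to \<open>e\<close>,
        \<open>wedge y e\<close> sends \<open>e\<close> to \<open>(e \<bullet> e) y\<close>, and the
        scalar normalizes this. It kills \<open>V\<close> because both vectors are orthogonal to
        \<open>V\<close>.\<close>
      let ?K = "(1 / (e \<bullet> e)) *\<^sub>R wedge y e"
      have "?K *v v = 0" if "v \<in> V" for v
        using ve[OF that] by (simp add: scaleR_matrix_vector_assoc[symmetric] wedge_apply)
      then have "?K \<in> skew_killing V"
        by (simp add: skew_killing_def transpose_scalar transpose_wedge)
      moreover have "?K *v e = y"
        using ye e(1) by (simp add: scaleR_matrix_vector_assoc[symmetric] wedge_apply)
      ultimately show "y \<in> ?f ` skew_killing V" by (metis image_eqI)
    qed
  qed
  moreover have "dim ?O + dim (span ?V) = dim (UNIV :: (real^'n) set)"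
    by (rule dim_subspace_orthogonal_to_vectors) auto
  then have "dim ?O = k" using Suc.hyps(2) d by simp
  moreover have "dim (skew_killing ?V) = k choose 2"
  proof -
    have "k = CARD('n) - dim ?V" using Suc.hyps(2) d by simp
    then show ?thesis using Suc.hyps(1)[of ?V] by simp
  qed
  ultimately have "dim (skew_killing V) = (k choose 2) + k"
    using dim_kernel_image[OF linear_apply_matrix subspace_skew_killing, of V e] ker by simp
  \<comment> \<open>Pascal's rule; writing 2 as a successor lets the recursion of the binomial
    apply.\<close>
  then show ?case using Suc.hyps(2)[symmetric] by (simp add: numeral_2_eq_2)
qed

text \<open>In codimension at most 1 the binomial of \<open>dim_skew_killing\<close> vanishes. This
  is why rank n - 1 suffices: both injectivity results below reduce to it.\<close>

lemma skew_zero_on_hyperplane: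
  fixes K :: "real^'n^'n"
  assumes "transpose K = - K" "\<And>x. x \<in> V \<Longrightarrow> K *v x = 0" "CARD('n) - 1 \<le> dim V"
  shows "K = 0"
proof -
  have "CARD('n) - dim V < 2" using assms(3) by linarith
  then have "dim (skew_killing V) = 0" by (simp add: dim_skew_killing binomial_eq_0)
  moreover have "K \<in> skew_killing V" using assms by (simp add: skew_killing_def)
  ultimately show ?thesis by (auto simp: dim_eq_0)
qed

text \<open>Cauchy-Schwarz row by row, the norm of a matrix being the Frobenius norm.\<close>

lemma norm_matrix_vector_le: "norm (A *v x) \<le> norm A * norm x" for A :: "real^'n^'m"
proof -
  have "norm (A *v x) = L2_set (\<lambda>i. \<bar>A $ i \<bullet> x\<bar>) UNIV"
    by (simp add: norm_vec_def mult_vec_entry)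
  also have "\<dots> \<le> L2_set (\<lambda>i. norm x * norm (A $ i)) UNIV"
    by (intro L2_set_mono) (metis Cauchy_Schwarz_ineq2 mult.commute, simp)
  also have "\<dots> = norm x * norm A"
    unfolding norm_vec_def[of A] by (rule L2_set_right_distrib[symmetric]) simp
  finally show ?thesis by (simp add: mult.commute)
qed

subsection \<open>Inverses of expanding matrices\<close>

text \<open>The constant 1 bounds all inverses uniformly, which makes inversion continuous. Both
  \<open>1 + K\<close> with \<open>K\<close> skew and \<open>1 + R\<close> with \<open>R\<close>
  near the identity qualify.\<close>

definition expanding :: "(real^'n^'n) set" where
  "expanding = {M. \<forall>x. norm x \<le> norm (M *v x)}"

lemma expanding_inverse:
  fixes M :: "real^'n^'n"
  assumes "M \<in> expanding"
  shows "matrix_inv M *v (M *v x) = x" and "M *v (matrix_inv M *v x) = x"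
proof -
  have "\<forall>x. M *v x = 0 \<longrightarrow> x = 0"
    using assms by (auto simp: expanding_def) (metis norm_le_zero_iff norm_zero)
  then have "invertible M"
    by (simp add: matrix_left_invertible_ker[symmetric] invertible_left_inverse)
  then have "M ** matrix_inv M = mat 1 \<and> matrix_inv M ** M = mat 1"
    unfolding invertible_def matrix_inv_def by (rule someI_ex)
  then show "matrix_inv M *v (M *v x) = x" and "M *v (matrix_inv M *v x) = x"
    by (simp_all add: matrix_vector_mul_assoc)
qed

lemma norm_expanding_inverse:
  "M \<in> expanding \<Longrightarrow> norm (matrix_inv M *v x) \<le> norm x" for M :: "real^'n^'n"
  using expanding_inverse(2)[of M x] unfolding expanding_def by (metis mem_Collect_eq)

lemma mult_axis_entry: "(A *v axis j 1) $ i = A $ i $ j" for A :: "real^'n^'m"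
  by (simp add: mult_vec_entry inner_axis)

lemma tendsto_matrix_vector:
  assumes "(f \<longlongrightarrow> (A :: real^'n^'m)) F"
  shows "((\<lambda>t. f t *v x) \<longlongrightarrow> A *v x) F"
  by (rule bounded_linear.tendsto[OF linear_conv_bounded_linear[THEN iffD1, OF linear_apply_matrix] assms])

lemma continuous_on_matrix_vector:
  assumes "continuous_on S (f :: _ \<Rightarrow> real^'n^'m)"
  shows "continuous_on S (\<lambda>t. f t *v x)"
  using assms tendsto_matrix_vector unfolding continuous_on_def by blast

lemma tendsto_matrixI:
  fixes f :: "_ \<Rightarrow> real^'n^'m"
  assumes "\<And>x. ((\<lambda>t. f t *v x) \<longlongrightarrow> A *v x) F"
  shows "(f \<longlongrightarrow> A) F"
  using tendsto_vec_nth[OF assms[of "axis _ 1"]]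
  by (intro vec_tendstoI) (simp add: mult_axis_entry)

text \<open>With \<open>y = M^-1 x\<close> fixed,
  \<open>M'^-1 x - M^-1 x = M'^-1 (M - M') y\<close>, whose norm is at most that of
  \<open>(M - M') y\<close> and so tends to 0.\<close>

lemma continuous_on_matrix_inv_expanding:
  "continuous_on expanding (matrix_inv :: real^'n^'n \<Rightarrow> real^'n^'n)"
  unfolding continuous_on_def
proof (intro ballI tendsto_matrixI)
  fix M :: "real^'n^'n" and x
  assume M: "M \<in> expanding"
  define y where "y = matrix_inv M *v x"
  have "((\<lambda>M'. (M - M') *v y) \<longlongrightarrow> (M - M) *v y) (at M within expanding)"
    by (intro tendsto_matrix_vector tendsto_intros)
  then have lim: "((\<lambda>M'. norm ((M - M') *v y)) \<longlongrightarrow> 0) (at M within expanding)"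
    by (simp add: tendsto_norm_zero)
  have "((\<lambda>M'. matrix_inv M' *v x - matrix_inv M *v x) \<longlongrightarrow> 0) (at M within expanding)"
  proof (rule Lim_null_comparison[OF _ lim])
    have "norm (matrix_inv M' *v x - matrix_inv M *v x) \<le> norm ((M - M') *v y)"
      if M': "M' \<in> expanding" for M'
    proof -
      have "matrix_inv M' *v ((M - M') *v y) = matrix_inv M' *v x - matrix_inv M *v x"
        using expanding_inverse(2)[OF M, of x] expanding_inverse(1)[OF M', of y]
        by (simp add: matrix_vector_mult_diff_rdistrib matrix_vector_mult_diff_distrib y_def)
      then show ?thesis using norm_expanding_inverse[OF M'] by metis
    qed
    then show "\<forall>\<^sub>F M' in at M within expanding.
        norm (matrix_inv M' *v x - matrix_inv M *v x) \<le> norm ((M - M') *v y)"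
      by (simp add: eventually_at_filter)
  qed
  then show "((\<lambda>M'. matrix_inv M' *v x) \<longlongrightarrow> matrix_inv M *v x) (at M within expanding)"
    by (simp add: Lim_null[symmetric])
qed

section \<open>Orthogonal and skew matrices through quadratic forms\<close>

lemma orthogonal_matrix_iff_norm:
  "orthogonal_matrix Q \<longleftrightarrow> (\<forall>x. norm (Q *v x) = norm x)" for Q :: "real^'n^'n"
  using orthogonal_transformation_matrix[of "(*v) Q"]
  by (simp add: orthogonal_transformation matrix_of_matrix_vector_mul)

lemma orthogonal_transpose_apply:
  assumes "orthogonal_matrix Q"
  shows "transpose Q *v (Q *v x) = x" and "Q *v (transpose Q *v x) = x"
  using assms by (simp_all add: orthogonal_matrix_def matrix_vector_mul_assoc)

lemma orthogonal_matrix_inner: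
  assumes "orthogonal_matrix (Q :: real^'n^'n)"
  shows "(Q *v x) \<bullet> (Q *v y) = x \<bullet> y"
  using assms orthogonal_transformation_matrix[of "(*v) Q"]
  by (simp add: orthogonal_transformation_def matrix_of_matrix_vector_mul)

lemma skew_self_dot:
  fixes K :: "real^'n^'n"
  assumes "transpose K = - K"
  shows "x \<bullet> (K *v x) = 0"
  using skew_dot[OF assms, of x x] by (simp add: inner_commute)

text \<open>Polarization on coordinate vectors.\<close>

lemma skew_iff_self_dot:
  "transpose K = - K \<longleftrightarrow> (\<forall>x. x \<bullet> (K *v x) = 0)" for K :: "real^'n^'n"
proof (intro iffI allI)
  assume *: "\<forall>x. x \<bullet> (K *v x) = 0"
  have "K $ j $ i = - K $ i $ j" for i j
  proof -
    let ?a = "axis i 1 :: real^'n" and ?b = "axis j 1 :: real^'n"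
    have "(?a + ?b) \<bullet> (K *v (?a + ?b)) - ?a \<bullet> (K *v ?a) - ?b \<bullet> (K *v ?b) = 0"
      using * by simp
    then have "?a \<bullet> (K *v ?b) + ?b \<bullet> (K *v ?a) = 0"
      by (simp add: matrix_vector_right_distrib inner_left_distrib inner_right_distrib)
    then show ?thesis by (simp add: inner_axis' mult_axis_entry)
  qed
  then have "transpose K $ i $ j = (- K) $ i $ j" for i j
    unfolding transpose_def vec_lambda_beta uminus_vec_def by blast
  then show "transpose K = - K"
    by (simp only: vec_eq_iff) blast
qed (rule skew_self_dot)

subsection \<open>The Cayley transform\<close>

text \<open>This form has one inverse and no matrix product, so continuity follows at once from that
  of \<open>matrix_inv\<close>.\<close>

definition cayley :: "real^'n^'n \<Rightarrow> real^'n^'n" where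
  "cayley K = matrix_inv (mat 1 + K) + matrix_inv (mat 1 + K) - mat 1"

lemma double_inject: "x + x = y + y \<longleftrightarrow> x = y" for x y :: "'a::real_vector"
  by (metis scaleR_2 scaleR_cancel_left zero_neq_numeral)

text \<open>As \<open>x\<close> is orthogonal to \<open>K x\<close>, the inner product of
  \<open>x\<close> with \<open>x + K x\<close> is the squared norm of \<open>x\<close>;
  Cauchy-Schwarz does the rest.\<close>

lemma skew_expanding:
  assumes "transpose K = - K"
  shows "mat 1 + K \<in> expanding"
proof -
  have "norm x \<le> norm (x + K *v x)" for x
  proof -
    have "norm x * norm x = x \<bullet> (x + K *v x)"
      by (simp add: inner_right_distrib skew_self_dot[OF assms] dot_square_norm power2_eq_square)
    also have "\<dots> \<le> norm x * norm (x + K *v x)"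
      by (rule norm_cauchy_schwarz)
    finally show ?thesis by (cases "x = 0") auto
  qed
  then show ?thesis
    by (simp add: expanding_def matrix_vector_mult_add_rdistrib)
qed

text \<open>The working form of the transform: every vector is some \<open>x + K x\<close> by
  \<open>expanding_onto\<close>, so later computations avoid the inverse.\<close>

lemma cayley_apply:
  assumes "mat 1 + K \<in> expanding"
  shows "cayley K *v (x + K *v x) = x - K *v x"
proof -
  have "matrix_inv (mat 1 + K) *v (x + K *v x) = x"
    using expanding_inverse(1)[OF assms, of x] by (simp add: matrix_vector_mult_add_rdistrib)
  then show ?thesis
    by (simp only: cayley_def matrix_vector_mult_diff_rdistrib matrix_vector_mult_add_rdistrib
        matrix_vector_mul_lid) simp
qed

lemma expanding_onto:
  assumes "mat 1 + K \<in> expanding"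
  obtains y where "x = y + K *v y"
  using expanding_inverse(2)[OF assms, of x] by (metis matrix_vector_mult_add_rdistrib matrix_vector_mul_lid)

text \<open>Orthogonality of \<open>y\<close> and \<open>K y\<close> gives \<open>y + K y\<close>
  and \<open>y - K y\<close> equal norms.\<close>

lemma orthogonal_cayley:
  assumes "transpose K = - K"
  shows "orthogonal_matrix (cayley K)"
  unfolding orthogonal_matrix_iff_norm
proof
  fix x
  obtain y where y: "x = y + K *v y"
    using expanding_onto[OF skew_expanding[OF assms]] .
  have "norm (y - K *v y) = norm (y + K *v y)"
    unfolding norm_eq using skew_self_dot[OF assms, of y]
    by (simp add: inner_commute algebra_simps)
  then show "norm (cayley K *v x) = norm x"
    unfolding y cayley_apply[OF skew_expanding[OF assms]] by simp
qed

lemma cayley_fixes: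
  assumes "transpose K = - K" "K *v w = 0"
  shows "cayley K *v w = w"
  using cayley_apply[OF skew_expanding[OF assms(1)], of w] assms(2) by simp

lemma continuous_on_cayley: "continuous_on {K. mat 1 + K \<in> expanding} cayley"
  unfolding cayley_def
  by (intro continuous_intros continuous_on_compose2[OF continuous_on_matrix_inv_expanding]) auto

text \<open>The inner product of \<open>y + R y\<close> and \<open>y - R y\<close> is the difference
  of the squared norms of \<open>y\<close> and \<open>R y\<close>, which is 0.\<close>

lemma skew_cayley:
  assumes "orthogonal_matrix R" "mat 1 + R \<in> expanding"
  shows "transpose (cayley R) = - cayley R"
  unfolding skew_iff_self_dot
proof
  fix x
  obtain y where y: "x = y + R *v y"
    using expanding_onto[OF assms(2)] .
  have "(R *v y) \<bullet> (R *v y) = y \<bullet> y"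
    using assms(1) by (simp add: orthogonal_matrix_inner)
  then show "x \<bullet> (cayley R *v x) = 0"
    unfolding y cayley_apply[OF assms(2)] by (simp add: inner_commute algebra_simps)
qed

text \<open>For \<open>x = y + R y\<close>, the sum and difference of \<open>x\<close> and
  \<open>cayley R x\<close> are \<open>2 y\<close> and \<open>2 R y\<close>; hence the second
  transform sends \<open>2 y\<close> to \<open>2 R y\<close>.\<close>

lemma cayley_involution:
  fixes R :: "real^'n^'n"
  assumes "mat 1 + R \<in> expanding" "mat 1 + cayley R \<in> expanding"
  shows "cayley (cayley R) = R"
proof -
  have "cayley (cayley R) *v y = R *v y" for y
  proof -
    let ?x = "y + R *v y"
    have "?x + cayley R *v ?x = y + y" "?x - cayley R *v ?x = R *v y + R *v y"
      unfolding cayley_apply[OF assms(1)] by simp_all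
    then show ?thesis
      using cayley_apply[OF assms(2), of ?x] by (simp only: matrix_vector_right_distrib double_inject \<open>?x + _ = _\<close> \<open>?x - _ = _\<close>)
  qed
  then show ?thesis by (simp add: matrix_eq)
qed

text \<open>Write \<open>1 + R\<close> as \<open>2 + (R - 1)\<close>: the perturbation lowers the
  factor 2 by at most 1.\<close>

lemma near_identity_expanding:
  fixes R :: "real^'n^'n"
  assumes "norm (R - mat 1) \<le> 1"
  shows "mat 1 + R \<in> expanding"
proof -
  have "norm x \<le> norm (x + R *v x)" for x
  proof -
    have "norm ((R - mat 1) *v x) \<le> norm x"
      using norm_matrix_vector_le[of "R - mat 1" x] mult_right_mono[OF assms, of "norm x"] by simp
    moreover have "norm (2 *\<^sub>R x) - norm ((R - mat 1) *v x) \<le> norm (x + R *v x)"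
    proof -
      have "x + R *v x = 2 *\<^sub>R x + (R - mat 1) *v x"
        unfolding scaleR_2 matrix_vector_mult_diff_rdistrib by simp
      then show ?thesis by (metis norm_diff_ineq)
    qed
    moreover have "norm (2 *\<^sub>R x) = 2 * norm x"
      unfolding norm_scaleR by simp
    ultimately show ?thesis by linarith
  qed
  then show ?thesis by (simp add: expanding_def matrix_vector_mult_add_rdistrib)
qed

text \<open>The rank hypothesis in terms of the set of rows, without the block matrix; see
  \<open>full_span_iff_rank\<close>.\<close>

definition full_span :: "real^'n^'m \<Rightarrow> real^'n \<Rightarrow> bool" where
  "full_span A W \<longleftrightarrow> CARD('n) - 1 \<le> dim (insert W (range (($) A)))"

text \<open>With \<open>Q = cayley K\<close> and \<open>q = Q\<^sup>T h\<close> one has \<open>K (h + q) = q - h\<close>; so if \<open>Q\<^sup>T\<close> and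
  \<open>Q'\<^sup>T\<close> agree on a hyperplane, the skew matrix \<open>K - K'\<close> vanishes on a hyperplane, hence is zero.\<close>

lemma cayley_translate_inj:
  fixes A :: "real^'n^'m"
  assumes "full_span A W" "K \<in> skew_killing {W}" "K' \<in> skew_killing {W}"
    and eq: "A ** cayley K = A ** cayley K'"
  shows "K = K'"
proof -
  let ?H = "insert W (range (($) A))"
  let ?Q = "cayley K" and ?Q' = "cayley K'"
  have K: "transpose K = - K" "K *v W = 0" and K': "transpose K' = - K'" "K' *v W = 0"
    using assms by (auto simp: skew_killing_def)
  note Q = orthogonal_transpose_apply[OF orthogonal_cayley[OF K(1)]]
  note Q' = orthogonal_transpose_apply[OF orthogonal_cayley[OF K'(1)]]
  have WQ: "transpose ?Q *v W = W" "transpose ?Q' *v W = W"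
    using Q(1)[of W] Q'(1)[of W] cayley_fixes[OF K] cayley_fixes[OF K'] by simp_all
  have same: "transpose ?Q *v h = transpose ?Q' *v h" if "h \<in> ?H" for h
    using that WQ eq by (elim insertE rangeE) (metis row_matrix_mult)+
  define g where "g h = h + transpose ?Q *v h" for h
  have lin: "linear g"
    unfolding g_def by (rule linear_compose_add[OF linear_ident matrix_vector_mul_linear])
  have kill: "L *v (h + transpose (cayley L) *v h) = transpose (cayley L) *v h - h"
    if L: "transpose L = - L" for h and L :: "real^'n^'n"
  proof -
    let ?q = "transpose (cayley L) *v h"
    obtain y where y: "?q = y + L *v y"
      using expanding_onto[OF skew_expanding[OF L]] .
    \<comment> \<open>\<open>cayley L\<close> sends \<open>?q\<close> back to \<open>h\<close> by
      orthogonality, and to \<open>y - L y\<close> by \<open>cayley_apply\<close>.\<close>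
    have "h = y - L *v y"
      using orthogonal_transpose_apply(2)[OF orthogonal_cayley[OF L], of h]
        cayley_apply[OF skew_expanding[OF L], of y] y by simp
    then have "h + ?q = y + y" "?q - h = L *v y + L *v y"
      using y by simp_all
    then show ?thesis by (simp only: matrix_vector_right_distrib)
  qed
  have "inj g"
  proof (rule linear_injective_0[OF lin, THEN iffD2], intro allI impI)
    fix h assume "g h = 0"
    then have "transpose ?Q *v h - h = 0" "h + transpose ?Q *v h = 0"
      using kill[OF K(1), of h] by (simp_all add: g_def)
    then show "h = 0" using double_inject[of h 0] by simp
  qed
  have "(K - K') *v y = 0" if "y \<in> g ` ?H" for y
  proof -
    from that obtain h where h: "y = g h" "h \<in> ?H" by (rule imageE)
    have "K *v y = transpose ?Q *v h - h"
      unfolding h(1) g_def by (rule kill[OF K(1)])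
    moreover have "K' *v y = transpose ?Q *v h - h"
      unfolding h(1) g_def same[OF h(2)] by (rule kill[OF K'(1)])
    ultimately have "K *v y = K' *v y" by metis
    then show ?thesis by (simp add: matrix_vector_mult_diff_rdistrib)
  qed
  moreover have "transpose (K - K') = - (K - K')"
    using K K' by (simp add: transpose_diff)
  moreover have "dim (g ` ?H) = dim ?H"
    using lin \<open>inj g\<close> by (intro dim_image_eq) (auto intro: inj_on_subset)
  ultimately have "K - K' = 0"
    using assms(1) by (intro skew_zero_on_hyperplane[of _ "g ` ?H"]) (auto simp: full_span_def)
  then show ?thesis by simp
qed

text \<open>Linearized counterpart of \<open>cayley_translate_inj\<close>: by skewness
  \<open>K\<close> kills the rows of \<open>A\<close> as well as \<open>W\<close>.\<close>

lemma mult_skew_killing_inj: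
  fixes A :: "real^'n^'m"
  assumes "full_span A W" "K \<in> skew_killing {W}" "A ** K = 0"
  shows "K = 0"
proof (rule skew_zero_on_hyperplane)
  show "CARD('n) - 1 \<le> dim (insert W (range (($) A)))"
    using assms(1) by (simp add: full_span_def)
  show "transpose K = - K" using assms(2) by (simp add: skew_killing_def)
  then have "K *v (A $ i) = - ((A ** K) $ i)" for i
    by (simp add: row_matrix_mult minus_matrix_vector)
  then show "K *v x = 0" if "x \<in> insert W (range (($) A))" for x
    using that assms(2,3) by (auto simp: skew_killing_def)
qed

subsection \<open>The stabilizer of a vector acts transitively on the fibre\<close>

text \<open>Householder reflection in the hyperplane orthogonal to \<open>u - v\<close>.\<close>

lemma reflection_exists:
  fixes u v :: "real^'n"
  assumes "norm u = norm v"
  obtains R :: "real^'n^'n" where "orthogonal_matrix R" "R *v u = v"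
    "\<And>x. x \<bullet> u = x \<bullet> v \<Longrightarrow> R *v x = x"
proof
  define d where "d = u - v"
  \<comment> \<open>For \<open>u = v\<close> the vector \<open>d\<close> is zero, the quotient by 0
    is 0, and \<open>f\<close> is the identity.\<close>
  define f where "f x = x - (2 * (d \<bullet> x) / (d \<bullet> d)) *\<^sub>R d" for x
  have "linear f"
    by (rule linearI) (simp_all add: f_def inner_right_distrib algebra_simps add_divide_distrib)
  then have f: "matrix f *v x = f x" for x
    by (simp add: linear_linear matrix_works)
  have "f x \<bullet> f x = x \<bullet> x" for x
    by (cases "d = 0") (simp_all add: f_def inner_diff_left inner_diff_right inner_commute field_simps)
  then show "orthogonal_matrix (matrix f)"
    by (simp add: orthogonal_matrix_iff_norm f norm_eq)
  have "d \<bullet> d = 2 * (d \<bullet> u)"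
    using assms by (simp add: norm_eq d_def inner_diff_left inner_diff_right inner_commute)
  then have "(2 * (d \<bullet> u) / (d \<bullet> d)) *\<^sub>R d = d"
    by (cases "d = 0") (simp_all flip: \<open>d \<bullet> d = _\<close>)
  then show "matrix f *v u = v"
    unfolding f f_def by (simp add: d_def)
  show "matrix f *v x = x" if "x \<bullet> u = x \<bullet> v" for x
  proof -
    have "d \<bullet> x = 0" using that unfolding d_def inner_diff_left by (simp add: inner_commute)
    then show ?thesis by (simp add: f f_def)
  qed
qed

definition stabilizer :: "real^'n \<Rightarrow> (real^'n^'n) set" where
  "stabilizer W = {Q. orthogonal_matrix Q \<and> Q *v W = W}"

lemma stabilizerD:
  assumes "Q \<in> stabilizer W"
  shows "orthogonal_matrix Q" and "Q *v W = W"
  using assms by (auto simp: stabilizer_def)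

lemma stabilizer_transpose: "Q \<in> stabilizer W \<Longrightarrow> transpose Q \<in> stabilizer W"
  using orthogonal_transpose_apply(1)[of Q W] by (auto simp: stabilizer_def)

lemma stabilizer_mult: "P \<in> stabilizer W \<Longrightarrow> Q \<in> stabilizer W \<Longrightarrow> P ** Q \<in> stabilizer W"
  by (auto simp: stabilizer_def orthogonal_matrix_mul simp flip: matrix_vector_mul_assoc)

lemma gram_fibre_mult_stabilizer:
  assumes "Q \<in> stabilizer W"
  shows "A ** Q \<in> gram_fibre A W"
proof -
  note Q = stabilizerD[OF stabilizer_transpose[OF assms]]
  show ?thesis
    unfolding gram_fibre_iff row_matrix_mult
    using orthogonal_matrix_inner[OF Q(1)] Q(2) by metis
qed

text \<open>The rows are matched one at a time: the reflection exchanging the image of the next row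
  with its target fixes \<open>W\<close> and all rows already matched, since the inner products agree.\<close>

lemma gram_fibre_transitive:
  fixes A A0 :: "real^'n^'m"
  assumes "A \<in> gram_fibre A0 W"
  obtains Q where "Q \<in> stabilizer W" "A = A0 ** Q"
proof -
  have A: "A $ i \<bullet> A $ j = A0 $ i \<bullet> A0 $ j" "A $ i \<bullet> W = A0 $ i \<bullet> W" for i j
    using assms by (auto simp: gram_fibre_iff)
  have "\<exists>P\<in>stabilizer W. \<forall>i\<in>I. P *v (A0 $ i) = A $ i" if "finite I" for I
    using that
  proof induction
    case empty
    then show ?case
      by (intro bexI[of _ "mat 1"]) (simp_all add: stabilizer_def orthogonal_matrix_id)
  next
    case (insert i I)
    then obtain P where P: "orthogonal_matrix P" "P *v W = W" "\<And>j. j \<in> I \<Longrightarrow> P *v (A0 $ j) = A $ j"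
      by (auto simp: stabilizer_def)
    let ?u = "P *v (A0 $ i)"
    have "norm ?u = norm (A $ i)"
      unfolding norm_eq by (simp add: orthogonal_matrix_inner[OF P(1)] A)
    then obtain R where R: "orthogonal_matrix R" "R *v ?u = A $ i"
        "\<And>x. x \<bullet> ?u = x \<bullet> A $ i \<Longrightarrow> R *v x = x"
      using reflection_exists by metis
    have "R *v W = W"
      by (rule R(3)) (metis A(2) P(1,2) inner_commute orthogonal_matrix_inner)
    moreover have "R *v (A $ j) = A $ j" if "j \<in> I" for j
      by (rule R(3)) (metis A(1) P(1,3) orthogonal_matrix_inner that)
    ultimately have "R ** P \<in> stabilizer W \<and> (\<forall>j\<in>insert i I. (R ** P) *v (A0 $ j) = A $ j)"
      using P R by (auto simp: stabilizer_def orthogonal_matrix_mul simp flip: matrix_vector_mul_assoc)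
    then show ?case by blast
  qed
  from this[OF finite[of UNIV]] obtain P where P: "P \<in> stabilizer W" "\<And>i. P *v (A0 $ i) = A $ i"
    by auto
  have "A = A0 ** transpose P"
    by (simp add: vec_eq_iff[of A] row_matrix_mult P(2))
  then show ?thesis using that stabilizer_transpose[OF P(1)] by blast
qed

text \<open>Closed as an intersection of closed conditions, and bounded because the rows are unit
  vectors.\<close>

lemma compact_stabilizer: "compact (stabilizer W)" for W :: "real^'n"
proof -
  have "stabilizer W = (\<Inter>x. {Q. norm (Q *v x) = norm x}) \<inter> {Q. Q *v W = W}"
    by (auto simp: stabilizer_def orthogonal_matrix_iff_norm)
  moreover have "closed {Q :: real^'n^'n. norm (Q *v x) = norm x}" for x
    by (intro closed_Collect_eq continuous_intros continuous_on_matrix_vector)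
  moreover have "closed {Q :: real^'n^'n. Q *v W = W}"
    by (intro closed_Collect_eq continuous_intros continuous_on_matrix_vector)
  ultimately have "closed (stabilizer W)" by (simp add: closed_INT closed_Int)
  moreover have "norm Q \<le> real CARD('n)" if "Q \<in> stabilizer W" for Q
  proof -
    have "norm (Q $ i) = 1" for i
    proof -
      have "Q $ i = transpose Q *v axis i 1"
        by (simp add: vec_eq_iff mult_axis_entry transpose_def)
      moreover have "norm (transpose Q *v axis i 1) = norm (axis i 1 :: real^'n)"
        using stabilizerD(1)[OF stabilizer_transpose[OF that]] orthogonal_matrix_iff_norm by blast
      ultimately show ?thesis by simp
    qed
    then show ?thesis
      using L2_set_le_sum[of UNIV "\<lambda>i. norm (Q $ i)"] by (simp add: norm_vec_def[of Q])
  qed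
  then have "bounded (stabilizer W)" unfolding bounded_iff by blast
  ultimately show ?thesis by (simp add: compact_eq_bounded_closed)
qed

lemma tendsto_matrix_mult_left:
  fixes B :: "real^'n^'m" and f :: "_ \<Rightarrow> real^'k^'n"
  assumes "(f \<longlongrightarrow> A) F"
  shows "((\<lambda>t. B ** f t) \<longlongrightarrow> B ** A) F"
proof (rule tendsto_matrixI)
  fix x
  have "((\<lambda>t. B *v (f t *v x)) \<longlongrightarrow> B *v (A *v x)) F"
    by (rule bounded_linear.tendsto[OF matrix_vector_mul_bounded_linear tendsto_matrix_vector[OF assms]])
  then show "((\<lambda>t. (B ** f t) *v x) \<longlongrightarrow> (B ** A) *v x) F"
    by (simp only: matrix_vector_mul_assoc)
qed

lemma continuous_on_matrix_mult_left:
  fixes B :: "real^'n^'m" and f :: "_ \<Rightarrow> real^'k^'n"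
  assumes "continuous_on S f"
  shows "continuous_on S (\<lambda>t. B ** f t)"
  using assms tendsto_matrix_mult_left unfolding continuous_on_def by blast

subsection \<open>Dimension of the fibre\<close>

text \<open>Otherwise points \<open>A0 Q n\<close> of the fibre tend to \<open>A0\<close>, and a
  subsequence of the \<open>Q n\<close> tends to some \<open>L\<close> with
  \<open>A0 L = A0\<close>. Replacing \<open>Q n\<close> by \<open>transpose L ** Q n\<close> leaves
  the points unchanged and moves the group elements to the identity.\<close>

lemma gram_fibre_near:
  fixes A0 :: "real^'n^'m" and W :: "real^'n"
  assumes "\<epsilon> > 0"
  shows "\<exists>\<delta>>0. \<forall>A\<in>gram_fibre A0 W. dist A A0 < \<delta>
      \<longrightarrow> (\<exists>R\<in>stabilizer W. dist R (mat 1) < \<epsilon> \<and> A = A0 ** R)"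
proof (rule ccontr)
  assume "\<not> ?thesis"
  then have "\<exists>A. A \<in> gram_fibre A0 W \<and> dist A A0 < \<delta> \<and>
      \<not> (\<exists>R\<in>stabilizer W. dist R (mat 1) < \<epsilon> \<and> A = A0 ** R)" if "\<delta> > 0" for \<delta>
    using that by blast
  then have "\<exists>A. A \<in> gram_fibre A0 W \<and> dist A A0 < inverse (real (Suc n)) \<and>
      \<not> (\<exists>R\<in>stabilizer W. dist R (mat 1) < \<epsilon> \<and> A = A0 ** R)" for n
    by simp
  then obtain A where A: "\<And>n. A n \<in> gram_fibre A0 W" "\<And>n. dist (A n) A0 < inverse (real (Suc n))"
      "\<And>n R. R \<in> stabilizer W \<Longrightarrow> dist R (mat 1) < \<epsilon> \<Longrightarrow> A n \<noteq> A0 ** R"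
    by metis
  have "\<exists>Q. Q \<in> stabilizer W \<and> A n = A0 ** Q" for n
    using gram_fibre_transitive[OF A(1)] by blast
  then obtain Q where Q: "\<And>n. Q n \<in> stabilizer W" "\<And>n. A n = A0 ** Q n"
    by metis
  obtain L r where L: "L \<in> stabilizer W" "strict_mono r" "(Q \<circ> r) \<longlonglongrightarrow> L"
    using compact_stabilizer[of W] Q(1) unfolding compact_def by metis
  have "(\<lambda>n. dist (A n) A0) \<longlonglongrightarrow> 0"
    by (rule tendsto_sandwich[OF _ _ tendsto_const LIMSEQ_inverse_real_of_nat])
      (intro always_eventually allI zero_le_dist less_imp_le A(2))+
  then have "A \<longlonglongrightarrow> A0" by (rule tendsto_dist_iff[THEN iffD2])
  then have "(A \<circ> r) \<longlonglongrightarrow> A0" using L(2) by (rule LIMSEQ_subseq_LIMSEQ)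
  moreover have "(\<lambda>n. A0 ** (Q \<circ> r) n) \<longlonglongrightarrow> A0 ** L"
    by (rule tendsto_matrix_mult_left[OF L(3)])
  then have "(A \<circ> r) \<longlonglongrightarrow> A0 ** L" by (simp add: o_def Q(2))
  ultimately have "A0 ** L = A0" using LIMSEQ_unique by blast
  moreover have L1: "transpose L ** L = mat 1" "L ** transpose L = mat 1"
    using stabilizerD(1)[OF L(1)] by (auto simp: orthogonal_matrix_def)
  ultimately have "A0 ** transpose L = A0"
    by (metis matrix_mul_assoc matrix_mul_rid)
  then have R: "A0 ** (transpose L ** Q n) = A n" for n
    by (simp add: matrix_mul_assoc Q(2))
  have "(\<lambda>n. transpose L ** (Q \<circ> r) n) \<longlonglongrightarrow> mat 1"
    using tendsto_matrix_mult_left[OF L(3), of "transpose L"] L1 by simp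
  then have "\<forall>\<^sub>F n in sequentially. dist (transpose L ** (Q \<circ> r) n) (mat 1) < \<epsilon>"
    using assms by (simp add: tendstoD)
  then obtain n where "dist (transpose L ** Q (r n)) (mat 1) < \<epsilon>"
    unfolding o_def eventually_sequentially by blast
  then show False
    using A(3)[of "transpose L ** Q (r n)" "r n"] R stabilizer_mult[OF stabilizer_transpose[OF L(1)] Q(1)]
    by metis
qed

text \<open>The invertible transpose of \<open>Q\<close> moves the rows and fixes \<open>W\<close>.
  So the rank hypothesis holds at every point of the fibre.\<close>

lemma full_span_mult_stabilizer:
  fixes A :: "real^'n^'m"
  assumes "full_span A W" "Q \<in> stabilizer W"
  shows "full_span (A ** Q) W"
proof -
  let ?f = "(*v) (transpose Q)"
  note Q = stabilizerD[OF stabilizer_transpose[OF assms(2)]]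
  have "insert W (range (($) (A ** Q))) = ?f ` insert W (range (($) A))"
    unfolding image_insert Q(2) image_image row_matrix_mult ..
  moreover have "inj ?f"
    using orthogonal_transpose_apply(1)[OF Q(1)] by (metis injI)
  ultimately have "dim (insert W (range (($) (A ** Q)))) = dim (insert W (range (($) A)))"
    by (metis dim_image_eq matrix_vector_mul_linear inj_on_subset subset_UNIV)
  then show ?thesis using assms(1) by (simp add: full_span_def)
qed

lemma cayley_in_stabilizer: "K \<in> skew_killing {W} \<Longrightarrow> cayley K \<in> stabilizer W"
  by (simp add: skew_killing_def stabilizer_def orthogonal_cayley cayley_fixes)

lemma cayley_in_skew_killing:
  assumes "R \<in> stabilizer W" "mat 1 + R \<in> expanding"
  shows "cayley R \<in> skew_killing {W}"
proof -
  note R = stabilizerD[OF assms(1)]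
  have "cayley R *v (W + W) = 0"
    using cayley_apply[OF assms(2), of W] R(2) by simp
  then have "cayley R *v W = 0"
    using double_inject[of "cayley R *v W" 0] unfolding matrix_vector_right_distrib by simp
  then show ?thesis using skew_cayley[OF R(1) assms(2)] by (simp add: skew_killing_def)
qed

lemma dim_gram_cell_le:
  fixes A0 :: "real^'n^'m" and W :: "real^'n"
  assumes "W \<noteq> 0" "full_span A0 W" "contains_dim_cell (gram_fibre A0 W) d"
  shows "d \<le> (CARD('n) - 1) choose 2"
proof -
  obtain T :: "(real^'n^'m) set" and U f where T: "subspace T" "dim T = d"
    and U: "openin (top_of_set T) U" "U \<noteq> {}" and fU: "f ` U \<subseteq> gram_fibre A0 W"
    and hom: "homeomorphism U (f ` U) f (inv_into U f)"
    using assms(3) unfolding contains_dim_cell_def by blast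
  obtain x0 where x0: "x0 \<in> U" using U by blast
  define A where "A = f x0"
  have "A \<in> gram_fibre A0 W" using x0 fU A_def by blast
  then have fibre: "gram_fibre A W = gram_fibre A0 W"
    by (auto simp: gram_fibre_def)
  have "full_span A W"
    using gram_fibre_transitive[OF \<open>A \<in> _\<close>] full_span_mult_stabilizer[OF assms(2)] by metis
  \<comment> \<open>Radius 1 is what \<open>near_identity_expanding\<close> allows; the closed ball
    keeps \<open>C\<close> compact, so that \<open>R \<mapsto> A R\<close> has a continuous inverse
    \<open>g\<close> on its image.\<close>
  define C where "C = stabilizer W \<inter> cball (mat 1) 1"
  have "compact C" unfolding C_def by (intro compact_Int_closed compact_stabilizer) simp
  have C: "R \<in> stabilizer W" "mat 1 + R \<in> expanding" "cayley R \<in> skew_killing {W}"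
      "cayley (cayley R) = R" if "R \<in> C" for R
  proof -
    show R: "R \<in> stabilizer W" "mat 1 + R \<in> expanding"
      using that by (auto simp: C_def dist_norm norm_minus_commute intro: near_identity_expanding)
    then show "cayley R \<in> skew_killing {W}" by (rule cayley_in_skew_killing)
    then show "cayley (cayley R) = R"
      by (intro cayley_involution[OF R(2) skew_expanding]) (simp add: skew_killing_def)
  qed
  have "inj_on (\<lambda>R. A ** R) C"
  proof (rule inj_onI)
    fix R R' assume RR: "R \<in> C" "R' \<in> C" "A ** R = A ** R'"
    then have "cayley R = cayley R'"
      using cayley_translate_inj[OF \<open>full_span A W\<close>, of "cayley R" "cayley R'"] by (simp add: C)
    then show "R = R'" using C(4) RR by metis
  qed
  then obtain g where g: "homeomorphism C ((\<lambda>R. A ** R) ` C) (\<lambda>R. A ** R) g"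
    using homeomorphism_compact[OF \<open>compact C\<close> continuous_on_matrix_mult_left[OF continuous_on_id]] by blast
  obtain \<delta> where \<delta>: "\<delta> > 0" "\<And>B. B \<in> gram_fibre A W \<Longrightarrow> dist B A < \<delta>
      \<Longrightarrow> \<exists>R\<in>stabilizer W. dist R (mat 1) < 1 \<and> B = A ** R"
    using gram_fibre_near[of 1 A W] by (metis zero_less_one)
  \<comment> \<open>Shrinking the cell puts its image inside \<open>A C\<close>, where
    \<open>g\<close> is defined.\<close>
  define V where "V = U \<inter> f -` ball A \<delta>"
  have contf: "continuous_on U f" using hom by (simp add: homeomorphism_def)
  have "openin (top_of_set U) V"
    unfolding V_def by (rule continuous_openin_preimage_gen[OF contf open_ball])
  then have V: "openin (top_of_set T) V" using U(1) openin_trans by blast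
  have "V \<noteq> {}" using x0 \<delta>(1) by (auto simp: V_def A_def)
  have fV: "f ` V \<subseteq> (\<lambda>R. A ** R) ` C"
  proof
    fix B assume "B \<in> f ` V"
    then have "B \<in> gram_fibre A W" "dist B A < \<delta>"
      using fU fibre by (auto simp: V_def dist_commute)
    then show "B \<in> (\<lambda>R. A ** R) ` C"
      using \<delta>(2)[of B] by (auto simp: C_def dist_commute)
  qed
  have gC: "g ` ((\<lambda>R. A ** R) ` C) = C" using g by (simp add: homeomorphism_def)
  \<comment> \<open>Each point of \<open>V\<close> goes to \<open>A R\<close>, then to
    \<open>R\<close> in \<open>C\<close>, then to \<open>cayley R\<close>; the last map is injective
    on \<open>C\<close> because the transform is an involution there.\<close>
  have "dim T \<le> dim (skew_killing {W})"
  proof (rule invariance_of_dimension_subspaces[OF V T(1) subspace_skew_killing _ _ _ \<open>V \<noteq> {}\<close>])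
    have "continuous_on V (g \<circ> f)"
      using g fV contf by (intro continuous_on_compose)
        (auto simp: homeomorphism_def V_def intro: continuous_on_subset)
    then show "continuous_on V (cayley \<circ> (g \<circ> f))"
      by (rule continuous_on_compose) (rule continuous_on_subset[OF continuous_on_cayley], use fV gC C(2) in \<open>auto simp: image_subset_iff\<close>)
    show "cayley \<circ> (g \<circ> f) \<in> V \<rightarrow> skew_killing {W}"
      using fV gC C(3) by fastforce
    show "inj_on (cayley \<circ> (g \<circ> f)) V"
    proof (rule inj_onI)
      fix x y assume xy: "x \<in> V" "y \<in> V" "(cayley \<circ> (g \<circ> f)) x = (cayley \<circ> (g \<circ> f)) y"
      then have fx: "f x \<in> (\<lambda>R. A ** R) ` C" and fy: "f y \<in> (\<lambda>R. A ** R) ` C"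
        using fV by auto
      then have "g (f x) \<in> C" "g (f y) \<in> C" using gC by blast+
      then have "g (f x) = g (f y)" using C(4) xy(3) unfolding o_def by metis
      then have "f x = f y"
        using homeomorphism_apply2[OF g fx] homeomorphism_apply2[OF g fy] by metis
      then show "x = y"
        using homeomorphism_apply1[OF hom] xy(1,2) unfolding V_def by (metis IntD1)
    qed
  qed
  \<comment> \<open>\<open>W \<noteq> 0\<close> makes \<open>dim {W} = 1\<close>, whence n -
    1.\<close>
  then show ?thesis using T(2) assms(1) by (simp add: dim_skew_killing)
qed

text \<open>A cell must be parametrized from a subspace of the space of m by n matrices itself. The
  skew matrices are therefore first embedded there by the injective linear map
  \<open>K \<mapsto> A0 K\<close>, which \<open>g\<close> undoes.\<close>

lemma contains_gram_cell:
  fixes A0 :: "real^'n^'m" and W :: "real^'n"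
  assumes "W \<noteq> 0" "full_span A0 W"
  shows "contains_dim_cell (gram_fibre A0 W) ((CARD('n) - 1) choose 2)"
proof -
  let ?L = "\<lambda>K::real^'n^'n. A0 ** K" and ?S = "skew_killing {W}"
  have lin: "linear ?L"
    by (rule linearI, simp add: matrix_add_ldistrib)
      (simp add: matrix_matrix_mult_def vec_eq_iff sum_distrib_left mult_ac)
  have inj: "inj_on ?L ?S"
  proof (rule inj_onI)
    fix K K' assume *: "K \<in> ?S" "K' \<in> ?S" "A0 ** K = A0 ** K'"
    then have "K - K' \<in> ?S" using subspace_diff[OF subspace_skew_killing] by blast
    moreover have "A0 ** (K - K') = 0" using linear_diff[OF lin, of K K'] * by simp
    ultimately show "K = K'" using mult_skew_killing_inj[OF assms(2)] by fastforce
  qed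
  obtain g where g: "range g \<subseteq> ?S" "linear g" "\<And>K. K \<in> ?S \<Longrightarrow> g (A0 ** K) = K"
    using linear_exists_left_inverse_on[OF lin subspace_skew_killing inj] by auto
  define T where "T = ?L ` ?S"
  have T: "subspace T" unfolding T_def by (rule linear_subspace_image[OF lin subspace_skew_killing])
  have "dim T = dim ?S"
    unfolding T_def using inj subspace_skew_killing[of "{W}"]
    by (intro dim_image_eq[OF lin]) (simp add: span_eq_iff[THEN iffD2])
  then have dT: "dim T = (CARD('n) - 1) choose 2"
    using assms(1) by (simp add: dim_skew_killing)
  define F where "F t = A0 ** cayley (g t)" for t
  have "continuous_on UNIV g" using g(2) by (simp add: linear_continuous_on linear_conv_bounded_linear)
  then have "continuous_on UNIV (\<lambda>t. cayley (g t))"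
    by (rule continuous_on_compose2[OF continuous_on_cayley])
      (use g(1) in \<open>auto simp: skew_killing_def intro: skew_expanding\<close>)
  then have contF: "continuous_on UNIV F"
    unfolding F_def by (rule continuous_on_matrix_mult_left)
  have injF: "inj_on F T"
  proof (rule inj_onI)
    fix s t assume *: "s \<in> T" "t \<in> T" "F s = F t"
    have "g s = g t"
      using *(3) g(1) by (intro cayley_translate_inj[OF assms(2)]) (auto simp: F_def)
    then show "s = t" using *(1,2) g(3) by (auto simp: T_def)
  qed
  \<comment> \<open>On the compact \<open>?D\<close> the continuous injection \<open>F\<close> is a
    homeomorphism onto its image; \<open>?U\<close> inside it is relatively open, as a cell
    requires.\<close>
  let ?U = "T \<inter> ball 0 1" and ?D = "T \<inter> cball 0 1"
  have "compact ?D" using T by (simp add: closed_Int_compact closed_subspace)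
  then obtain k where k: "homeomorphism ?D (F ` ?D) F k"
    using homeomorphism_compact[of ?D F] contF injF
    by (metis continuous_on_subset inf_le1 inj_on_subset subset_UNIV)
  have sub: "?U \<subseteq> ?D" by auto
  have "homeomorphism ?U (F ` ?U) F k"
    by (rule homeomorphism_of_subsets[OF k]) (use sub in auto)
  moreover have "inj_on F ?U" using injF inj_on_subset by blast
  ultimately have "homeomorphism ?U (F ` ?U) F (inv_into ?U F)"
    by (rule_tac homeomorphism_cong[where f = F and g = k]) (auto simp: homeomorphism_apply1 inv_into_f_f)
  moreover have "openin (top_of_set T) ?U" by (simp add: openin_open_Int)
  moreover have "?U \<noteq> {}" using subspace_0[OF T] by (auto intro!: exI[of _ 0])
  moreover have "F ` ?U \<subseteq> gram_fibre A0 W"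
    using g(1) by (auto simp: F_def intro!: gram_fibre_mult_stabilizer cayley_in_stabilizer)
  ultimately show ?thesis
    unfolding contains_dim_cell_def using T dT by blast
qed

section \<open>The rank hypothesis and the conclusion\<close>

lemma full_span_iff_rank:
  fixes A0 :: "real^'n^'m" and W :: "real^'n"
  shows "full_span A0 W \<longleftrightarrow>
    rank ((\<chi> i. case i of None \<Rightarrow> W | Some k \<Rightarrow> A0 $ k) :: real^'n^('m option)) \<ge> CARD('n) - 1"
proof -
  have "rows ((\<chi> i. case i of None \<Rightarrow> W | Some k \<Rightarrow> A0 $ k) :: real^'n^('m option))
      = insert W (range (($) A0))"
    by (auto simp: rows_def row_def UNIV_option_conv image_iff vec_nth_inverse split: option.splits)
  then show ?thesis by (simp add: full_span_def row_rank_def)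
qed

theorem theorem2:
  fixes A0 :: "real^'n^'m" and W :: "real^'n"
  assumes "W \<noteq> 0"
    and "rank ((\<chi> i. case i of None \<Rightarrow> W | Some k \<Rightarrow> A0 $ k) :: real^'n^('m option))
           \<ge> CARD('n) - 1"
  shows "real_algebraic_set
           {A :: real^'n^'m. A ** transpose A = A0 ** transpose A0 \<and> A *v W = A0 *v W}
       \<and> alg_dim
           {A :: real^'n^'m. A ** transpose A = A0 ** transpose A0 \<and> A *v W = A0 *v W}
         = (CARD('n) - 1) * (CARD('n) - 2) div 2"
  unfolding gram_fibre_def[symmetric]
proof
  show "real_algebraic_set (gram_fibre A0 W)" by (rule real_algebraic_gram_fibre)
  have full: "full_span A0 W" using assms(2) by (simp only: full_span_iff_rank)
  \<comment> \<open>The cell shows that the value is attained, the upper bound that it is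
    maximal.\<close>
  have "alg_dim (gram_fibre A0 W) = (CARD('n) - 1) choose 2"
    unfolding alg_dim_def
    using contains_gram_cell[OF assms(1) full] dim_gram_cell_le[OF assms(1) full]
    by (rule Greatest_equality)
  then show "alg_dim (gram_fibre A0 W) = (CARD('n) - 1) * (CARD('n) - 2) div 2"
    by (simp only: choose_two diff_diff_left one_add_one)
qed

end
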